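(* Let $(\mathbb{X},\mathcal{X})$ be a measurable space. Let $\xi$ be a point process on $\mathbb{X}$ with finite intensity measure, and let $\eta$ be a Poisson process on $\mathbb{X}$ with finite intensity measure $\lambda$. For any $i\in\mathbb{N}$ and any $i$-tuple $(A_1,\dots,A_i)\in\mathcal{X}^i_{\mathrm{disj}}$, let $\mathbf{Z}^{A_{1:i}}=(Z^{A_{1:i}}_1,\dots,Z^{A_{1:i}}_i)$ be a random vector with values in $\mathbb{Z}^i$ defined on the same probability space as $\xi$, and define $$q^{A_{1:i}}_{m_{1:i}}=m_i\,\mathbb{P}\big((\xi(A_1),\dots,\xi(A_i))=m_{1:i}\big)-\lambda(A_i)\,\mathbb{P}\big((\xi(A_1),\dots,\xi(A_i))+\mathbf{Z}^{A_{1:i}}=(m_{1:i-1},m_i-1)\big)$$ for $m_{1:i}\in\mathbb{N}_0^i$ with $m_i\neq 0$. Then $$d_\pi(\xi,\eta)\le\sup_{(A_1,\dots,A_d)\in\mathcal{X}^d_{\mathrm{disj}},\,d\in\mathbb{N}}\ \sum_{i=1}^d\left(\sum_{\substack{m_{1:i}\in\mathbb{N}_0^i\\ m_i\neq 0}}\big|q^{A_{1:i}}_{m_{1:i}}\big|+2\lambda(A_i)\sum_{j=1}^i\mathbb{E}\big|Z^{A_{1:i}}_j\big|\right).$$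
   Context: $\mathbb{N}_0=\mathbb{N}\cup\{0\}$. For a vector $m=(m_1,\dots,m_d)$, $m_{1:j}$ denotes $(m_1,\dots,m_j)$; similarly $A_{1:i}=(A_1,\dots,A_i)$. $\mathsf{N}_{\mathbb{X}}$ is the collection of all $\sigma$-finite counting measures on $(\mathbb{X},\mathcal{X})$, equipped with the smallest $\sigma$-field $\mathcal{N}_{\mathbb{X}}$ making $\nu\mapsto\nu(B)$ measurable for all $B\in\mathcal{X}$. A point process on $\mathbb{X}$ is a random element of $(\mathsf{N}_{\mathbb{X}},\mathcal{N}_{\mathbb{X}})$; its intensity measure is $B\mapsto\mathbb{E}[\xi(B)]$, $B\in\mathcal{X}$. $\mathcal{X}^d_{\mathrm{disj}}=\{(A_1,\dots,A_d)\in\mathcal{X}^d: A_i\cap A_j=\emptyset,\ i\neq j\}$. For point processes $\xi,\zeta$ on $\mathbb{X}$ with finite intensity measure, $$d_\pi(\xi,\zeta)=\sup_{(A_1,\dots,A_d)\in\mathcal{X}^d_{\mathrm{disj}},\,d\in\mathbb{N}}d_W\big((\xi(A_1),\dots,\xi(A_d)),(\zeta(A_1),\dots,\zeta(A_d))\big),$$ where for integrable random vectors $\mathbf{X},\mathbf{Y}$ in $\mathbb{N}_0^d$, $d_W(\mathbf{X},\mathbf{Y})=\sup_{g}|\mathbb{E}[g(\mathbf{X})]-\mathbb{E}[g(\mathbf{Y})]|$, the supremum being over all $g:\mathbb{N}_0^d\to\mathbb{R}$ with $|g(\mathbf{x})-g(\mathbf{y})|\le\sum_{i=1}^d|x_i-y_i|$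 for all $\mathbf{x},\mathbf{y}\in\mathbb{N}_0^d$. (When the intensity measure is finite, these vectors take values in $\mathbb{N}_0^d$ almost surely.) *)

theory Defs
  imports "HOL-Probability.Probability"
begin

text \<open>
  A measurable space is represented by a measure \<open>X\<close> of which only \<open>space X\<close> and \<open>sets X\<close> are used.
  Vectors with \<open>d\<close> components and \<open>d\<close>-tuples of sets are lists of length \<open>d\<close>, so that the prefix
  of length \<open>i\<close> is \<open>take i\<close>.
\<close>

definition counting_measures :: "'a measure \<Rightarrow> 'a measure set" where
  "counting_measures X =
     {\<nu>. sets \<nu> = sets X \<and> sigma_finite_measure \<nu> \<and>
          (\<forall>B\<in>sets X. emeasure \<nu> B \<in> range of_nat \<union> {\<infinity>})}"

definition counting_measure_space :: "'a measure \<Rightarrow> 'a measure measure" where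
  "counting_measure_space X =
     sigma (counting_measures X)
       {{\<nu> \<in> counting_measures X. emeasure \<nu> B \<in> U} | B U. B \<in> sets X \<and> U \<in> sets borel}"

definition point_process :: "'w measure \<Rightarrow> 'a measure \<Rightarrow> ('w \<Rightarrow> 'a measure) \<Rightarrow> bool" where
  "point_process P X \<xi> \<longleftrightarrow> prob_space P \<and> \<xi> \<in> P \<rightarrow>\<^sub>M counting_measure_space X"

definition intensity_measure :: "'w measure \<Rightarrow> 'a measure \<Rightarrow> ('w \<Rightarrow> 'a measure) \<Rightarrow> 'a measure" where
  "intensity_measure P X \<xi> =
     measure_of (space X) (sets X) (\<lambda>B. \<integral>\<^sup>+ \<omega>. emeasure (\<xi> \<omega>) B \<partial>P)"

definition disj_tuples :: "'a measure \<Rightarrow> 'a set list set" where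
  "disj_tuples X =
     {A. A \<noteq> [] \<and> set A \<subseteq> sets X \<and> disjoint_family_on (\<lambda>i. A ! i) {..<length A}}"

text \<open>
  The Poisson probabilities are written out because the rate \<open>\<Lambda>(B)\<close> may be \<open>0\<close>, where they give
  the point mass at \<open>0\<close> (by \<open>0 ^ 0 = 1\<close>); rate \<open>\<infinity>\<close> means the point mass at \<open>\<infinity>\<close>.
\<close>

definition poisson_process ::
    "'w measure \<Rightarrow> 'a measure \<Rightarrow> 'a measure \<Rightarrow> ('w \<Rightarrow> 'a measure) \<Rightarrow> bool" where
  "poisson_process P X \<Lambda> \<eta> \<longleftrightarrow>
     point_process P X \<eta> \<and> sets \<Lambda> = sets X \<and>
     (\<forall>B\<in>sets X.
        if emeasure \<Lambda> B = \<infinity> then (AE \<omega> in P. emeasure (\<eta> \<omega>) B = \<infinity>)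
        else (\<forall>k. measure P {\<omega> \<in> space P. emeasure (\<eta> \<omega>) B = of_nat k} =
                  measure \<Lambda> B ^ k / fact k * exp (- measure \<Lambda> B))) \<and>
     (\<forall>A\<in>disj_tuples X.
        prob_space.indep_vars P (\<lambda>_. borel) (\<lambda>i \<omega>. emeasure (\<eta> \<omega>) (A ! i)) {..<length A})"

text \<open>
  The counts \<open>(\<nu>(A\<^sub>1), \<dots>, \<nu>(A\<^sub>d))\<close> as a vector of natural numbers. An infinite count is
  replaced by \<open>0\<close>; for a point process with finite intensity measure this affects a null set only.
\<close>

definition counts :: "'a measure \<Rightarrow> 'a set list \<Rightarrow> nat list" where
  "counts \<nu> A = map (\<lambda>B. nat \<lfloor>measure \<nu> B\<rfloor>) A"

definition lipschitz1 :: "nat \<Rightarrow> (nat list \<Rightarrow> real) set" where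
  "lipschitz1 d =
     {g. \<forall>x y. length x = d \<longrightarrow> length y = d \<longrightarrow>
           \<bar>g x - g y\<bar> \<le> (\<Sum>i<d. \<bar>real (x ! i) - real (y ! i)\<bar>)}"

definition wasserstein ::
    "nat \<Rightarrow> 'w measure \<Rightarrow> ('w \<Rightarrow> nat list) \<Rightarrow> 'v measure \<Rightarrow> ('v \<Rightarrow> nat list) \<Rightarrow> ennreal" where
  "wasserstein d P U Q V =
     (SUP g\<in>lipschitz1 d. ennreal \<bar>(\<integral>\<omega>. g (U \<omega>) \<partial>P) - (\<integral>\<omega>. g (V \<omega>) \<partial>Q)\<bar>)"

definition dist_pi ::
    "'a measure \<Rightarrow> 'w measure \<Rightarrow> ('w \<Rightarrow> 'a measure) \<Rightarrow> 'v measure \<Rightarrow> ('v \<Rightarrow> 'a measure) \<Rightarrow> ennreal" where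
  "dist_pi X P \<xi> Q \<zeta> =
     (SUP A\<in>disj_tuples X. wasserstein (length A) P (\<lambda>\<omega>. counts (\<xi> \<omega>) A) Q (\<lambda>\<omega>. counts (\<zeta> \<omega>) A))"

text \<open>
  The coefficient \<open>q\<close> of the tuple \<open>A\<close> and the vector \<open>m\<close>, where \<open>Z\<close> is the random vector attached
  to \<open>A\<close>. It is meant for \<open>length m = length A\<close> and \<open>last m \<noteq> 0\<close>, so that \<open>last m - 1\<close> is not truncated.
\<close>

definition q_coeff ::
    "'w measure \<Rightarrow> ('w \<Rightarrow> 'a measure) \<Rightarrow> 'a measure \<Rightarrow> 'a set list \<Rightarrow> ('w \<Rightarrow> int list) \<Rightarrow> nat list \<Rightarrow> real" where
  "q_coeff P \<xi> \<Lambda> A Z m =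
     real (last m) * measure P {\<omega> \<in> space P. counts (\<xi> \<omega>) A = m} -
     measure \<Lambda> (last A) *
       measure P {\<omega> \<in> space P.
         map2 (+) (map int (counts (\<xi> \<omega>) A)) (Z \<omega>) = map int (butlast m @ [last m - 1])}"

end

theory Submission
  imports Defs
begin

text \<open>
  The counts of \<open>\<xi>\<close> are replaced by independent Poisson variables one coordinate at a time, from the
  last to the first. Integrating a 1-Lipschitz \<open>g\<close> over the coordinates already replaced gives a
  1-Lipschitz \<open>h\<close> of the remaining ones, so it suffices to compare \<open>h(\<xi>(A\<^sub>1), \<dots>, \<xi>(A\<^sub>i))\<close> with its
  Poisson mean in the last coordinate. With the solution \<open>f\<close> of the Stein equation
  \<open>\<lambda> f(x, k + 1) - k f(x, k) = h(x, k) - E h(x, Po(\<lambda>))\<close>, the difference is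
  \<open>E (\<lambda> f(N + e\<^sub>i) - N\<^sub>i f(N))\<close>, and inserting the definition of \<open>q\<close> turns it into
  \<open>\<lambda> E (f(N + e\<^sub>i) - f(N + Z + e\<^sub>i)) - \<Sum> q\<^sub>m f(m)\<close>.
  Now \<open>\<bar>f\<bar> \<le> 1\<close> because \<open>h\<close> is 1-Lipschitz in \<open>k\<close>. The equation is linear and a function bounded
  by \<open>L\<close> is \<open>2L\<close>-Lipschitz on the natural numbers, so \<open>f\<close> is 2-Lipschitz in all coordinates,
  which accounts for the factor 2.
\<close>

section \<open>Stein equation for the Poisson distribution\<close>

definition pois :: "real \<Rightarrow> nat \<Rightarrow> real" where
  "pois l k = l ^ k / fact k * exp (- l)"

definition pois_mean :: "real \<Rightarrow> (nat \<Rightarrow> real) \<Rightarrow> real" where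
  "pois_mean l u = (\<Sum>k. u k * pois l k)"

text \<open>The constant \<open>L\<close> is a parameter because several values occur: 1 for
  sections of a function in \<open>lipschitz1\<close>, 0 for constants, and 2L for functions bounded
  by L.\<close>

definition lip :: "real \<Rightarrow> (nat \<Rightarrow> real) \<Rightarrow> bool" where
  "lip L u \<longleftrightarrow> (\<forall>j k. \<bar>u j - u k\<bar> \<le> L * \<bar>real j - real k\<bar>)"

lemma pois_nonneg: "0 \<le> l \<Longrightarrow> 0 \<le> pois l k"
  by (simp add: pois_def)

lemma pois_pos: "0 < l \<Longrightarrow> 0 < pois l k"
  by (simp add: pois_def)

text \<open>This recursion of the weights yields the Poisson mean and lets the Stein equation
  telescope.\<close>

lemma Suc_mult_pois: "real (Suc k) * pois l (Suc k) = l * pois l k"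
  unfolding pois_def fact_Suc power_Suc of_nat_mult
  by (simp add: field_simps del: of_nat_Suc)

lemma pois_sums: "pois l sums 1"
proof -
  have "(\<lambda>k. l ^ k /\<^sub>R fact k * exp (- l)) sums (exp l * exp (- l))"
    by (intro sums_mult2 exp_converges)
  then show ?thesis
    by (simp add: pois_def[abs_def] exp_minus divide_inverse mult.commute[of "inverse (fact _)"])
qed

lemma pois_id_sums: "(\<lambda>k. real k * pois l k) sums l"
proof -
  have "(\<lambda>k. real (Suc k) * pois l (Suc k)) sums l"
    unfolding Suc_mult_pois using sums_mult[OF pois_sums, of l l] by simp
  then show ?thesis
    by (subst (asm) sums_Suc_iff) simp
qed

lemma pois_zero: "pois 0 k = (if k = 0 then 1 else 0)"
  by (simp add: pois_def)

lemma lip_nonneg: "lip L u \<Longrightarrow> 0 \<le> L"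
  unfolding lip_def by (drule spec[of _ 0], drule spec[of _ 1]) simp

text \<open>\<open>u\<close> grows at most linearly, and the Poisson distribution has a finite
  mean.\<close>

lemma summable_pois_lip:
  assumes "0 \<le> l" "lip L u"
  shows "summable (\<lambda>k. u k * pois l k)"
proof (rule summable_comparison_test')
  show "summable (\<lambda>k. \<bar>u 0\<bar> * pois l k + L * (real k * pois l k))"
    using pois_sums pois_id_sums by (intro summable_add summable_mult) (auto simp: sums_iff)
  fix k
  have "\<bar>u k\<bar> \<le> \<bar>u 0\<bar> + L * real k"
    using assms(2)[unfolded lip_def, rule_format, of k 0] by simp
  then show "norm (u k * pois l k) \<le> \<bar>u 0\<bar> * pois l k + L * (real k * pois l k)"
    using pois_nonneg[OF assms(1), of k]
    by (simp add: abs_mult) (metis distrib_right mult.assoc mult_right_mono)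
qed

lemma lip_add: "lip L u \<Longrightarrow> lip K v \<Longrightarrow> lip (L + K) (\<lambda>k. u k + v k)"
  unfolding lip_def
proof (intro allI)
  fix j k
  assume "\<forall>j k. \<bar>u j - u k\<bar> \<le> L * \<bar>real j - real k\<bar>" "\<forall>j k. \<bar>v j - v k\<bar> \<le> K * \<bar>real j - real k\<bar>"
  then have "\<bar>u j - u k\<bar> \<le> L * \<bar>real j - real k\<bar>" "\<bar>v j - v k\<bar> \<le> K * \<bar>real j - real k\<bar>"
    by auto
  then show "\<bar>u j + v j - (u k + v k)\<bar> \<le> (L + K) * \<bar>real j - real k\<bar>"
    unfolding distrib_right by linarith
qed

lemma lip_uminus: "lip L u \<Longrightarrow> lip L (\<lambda>k. - u k)"
  unfolding lip_def by (simp add: abs_minus_commute)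

lemma lip_linear: "0 \<le> L \<Longrightarrow> lip L (\<lambda>k. L * real k)"
  unfolding lip_def by (simp add: abs_mult right_diff_distrib[symmetric])

text \<open>Distinct natural numbers are at least 1 apart, while two values of \<open>u\<close>
  differ by at most 2L.\<close>

lemma lip_bounded:
  assumes "\<And>k. \<bar>u k\<bar> \<le> L"
  shows "lip (2 * L) u"
  unfolding lip_def
proof (intro allI)
  fix j k :: nat
  have "0 \<le> L" using assms[of 0] by linarith
  show "\<bar>u j - u k\<bar> \<le> 2 * L * \<bar>real j - real k\<bar>"
  proof (cases "j = k")
    case False
    then have "2 * L * 1 \<le> 2 * L * \<bar>real j - real k\<bar>"
      using \<open>0 \<le> L\<close> by (intro mult_left_mono) linarith+
    then show ?thesis
      using assms[of j] assms[of k] by linarith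
  qed simp
qed

lemma pois_mean_add:
  assumes "0 \<le> l" "lip L u" "lip K v"
  shows "pois_mean l (\<lambda>k. u k + v k) = pois_mean l u + pois_mean l v"
  unfolding pois_mean_def distrib_right
  by (rule suminf_add[symmetric, OF summable_pois_lip[OF assms(1,2)] summable_pois_lip[OF assms(1,3)]])

lemma pois_mean_uminus:
  assumes "0 \<le> l" "lip L u"
  shows "pois_mean l (\<lambda>k. - u k) = - pois_mean l u"
  unfolding pois_mean_def using suminf_minus[OF summable_pois_lip[OF assms]] by simp

lemma pois_mean_linear: "pois_mean l (\<lambda>k. L * real k) = L * l"
  unfolding pois_mean_def using sums_mult[OF pois_id_sums, of L l] by (simp add: sums_iff mult.assoc)

lemma pois_mean_const: "pois_mean l (\<lambda>k. c) = c"
  unfolding pois_mean_def using sums_mult[OF pois_sums, of c l] by (simp add: sums_iff)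

lemma pois_mean_zero: "pois_mean 0 u = u 0"
proof -
  have "(\<lambda>k. u k * pois 0 k) sums (\<Sum>k\<in>{0}. u k * pois 0 k)"
    by (rule sums_finite) (auto simp: pois_zero)
  then show ?thesis by (simp add: pois_mean_def sums_iff pois_zero)
qed

lemma pois_mean_mono:
  assumes "0 \<le> l" "lip L u" "lip K v" "\<And>k. u k \<le> v k"
  shows "pois_mean l u \<le> pois_mean l v"
  unfolding pois_mean_def
  by (rule suminf_le[OF _ summable_pois_lip[OF assms(1,2)] summable_pois_lip[OF assms(1,3)]])
    (intro mult_right_mono assms pois_nonneg)

text \<open>Multiplied by \<open>pois l k\<close>, the Stein equation telescopes by
  \<open>Suc_mult_pois\<close>: for a solution f, these partial sums are
  \<open>real k * pois l k * f k\<close>.\<close>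

definition stein_sum :: "real \<Rightarrow> (nat \<Rightarrow> real) \<Rightarrow> nat \<Rightarrow> real" where
  "stein_sum l u k = (\<Sum>j<k. (u j - pois_mean l u) * pois l j)"

text \<open>The increments of \<open>stein_sum l v\<close> are first nonpositive and then nonnegative, and its limit is \<open>0\<close>.\<close>

lemma stein_sum_mono_le_0:
  assumes l: "0 \<le> l" and v: "lip L v" and "mono v"
  shows "stein_sum l v k \<le> 0"
proof (cases "v k \<le> pois_mean l v")
  case True
  have "v j - pois_mean l v \<le> 0" if "j < k" for j
    using monoD[OF \<open>mono v\<close>, of j k] that True by linarith
  then show ?thesis
    unfolding stein_sum_def
    by (intro sum_nonpos mult_nonpos_nonneg pois_nonneg l) auto
next
  case False
  have "(\<lambda>j. v j * pois l j - pois_mean l v * pois l j) sums (pois_mean l v - pois_mean l v * 1)"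
    using summable_pois_lip[OF l v] unfolding pois_mean_def
    by (intro sums_diff sums_mult pois_sums) (rule summable_sums)
  then have s: "(\<lambda>j. (v j - pois_mean l v) * pois l j) sums 0"
    by (simp add: left_diff_distrib)
  have "0 \<le> v j - pois_mean l v" if "k \<le> j" for j
    using monoD[OF \<open>mono v\<close>, of k j] that False by linarith
  then have "stein_sum l v k \<le> (\<Sum>j. (v j - pois_mean l v) * pois l j)"
    unfolding stein_sum_def using s
    by (intro sum_le_suminf) (auto simp: sums_iff intro!: mult_nonneg_nonneg pois_nonneg l)
  then show ?thesis
    using s by (simp add: sums_iff)
qed

lemma stein_sum_add:
  assumes "0 \<le> l" "lip L u" "lip K v"
  shows "stein_sum l (\<lambda>k. u k + v k) k = stein_sum l u k + stein_sum l v k"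
  unfolding stein_sum_def pois_mean_add[OF assms]
  by (simp add: sum.distrib[symmetric] algebra_simps)

lemma stein_sum_uminus:
  assumes "0 \<le> l" "lip L u"
  shows "stein_sum l (\<lambda>k. - u k) k = - stein_sum l u k"
  unfolding stein_sum_def pois_mean_uminus[OF assms]
  by (simp add: sum_negf[symmetric] algebra_simps)

text \<open>The Stein equation for \<open>L * real k\<close> is solved by the constant
  \<open>- L\<close>; this is the same fact in terms of partial sums.\<close>

lemma stein_sum_linear: "stein_sum l (\<lambda>k. L * real k) k = - L * (real k * pois l k)"
proof (induction k)
  case 0
  then show ?case by (simp add: stein_sum_def)
next
  case (Suc k)
  then show ?case
    unfolding Suc_mult_pois by (simp add: stein_sum_def pois_mean_linear algebra_simps)
qed

text \<open>Adding \<open>L * real k\<close> makes an L-Lipschitz function nondecreasing, so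
  \<open>stein_sum_mono_le_0\<close> applies to the sum, and the contribution of the linear part is
  explicit. The same argument for \<open>- u\<close> gives the other side.\<close>

lemma abs_stein_sum_le:
  assumes l: "0 \<le> l" and u: "lip L u"
  shows "\<bar>stein_sum l u k\<bar> \<le> L * (real k * pois l k)"
proof -
  have *: "stein_sum l w k \<le> L * (real k * pois l k)" if w: "lip L w" for w
  proof -
    have L: "lip L (\<lambda>k. L * real k)"
      using lip_linear lip_nonneg[OF u] by blast
    have "mono (\<lambda>k. w k + L * real k)"
    proof
      fix i j :: nat assume "i \<le> j"
      then show "w i + L * real i \<le> w j + L * real j"
        using w[unfolded lip_def, rule_format, of i j] by (simp add: right_diff_distrib)
    qed
    from stein_sum_mono_le_0[OF l lip_add[OF w L] this, of k]
    show ?thesis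
      using stein_sum_add[OF l w L, of k] stein_sum_linear[of l L k] by simp
  qed
  show ?thesis
    using *[OF u] *[OF lip_uminus[OF u]] stein_sum_uminus[OF l u, of k] by linarith
qed

text \<open>At \<open>k = 0\<close> both branches give \<open>0\<close>, since \<open>x / 0 = 0\<close>.\<close>

definition stein :: "real \<Rightarrow> (nat \<Rightarrow> real) \<Rightarrow> nat \<Rightarrow> real" where
  "stein l u k = (if l = 0 then (u 0 - u k) / real k else stein_sum l u k / (real k * pois l k))"

lemma stein_equation:
  assumes "0 \<le> l"
  shows "l * stein l u (Suc k) - real k * stein l u k = u k - pois_mean l u"
proof (cases "l = 0")
  case True
  \<comment> \<open>At rate 0 the Poisson mean is \<open>u 0\<close> and the equation reads - k f(k)
    = u(k) - u(0), which this branch of \<open>stein\<close> solves by division; at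
    \<open>k = 0\<close> both sides are 0.\<close>
  then show ?thesis by (simp add: stein_def pois_mean_zero)
next
  case False
  with assms have p: "0 < l" "pois l k > 0" by (auto intro: pois_pos)
  have 1: "l * stein l u (Suc k) = stein_sum l u (Suc k) / pois l k"
    using p unfolding stein_def Suc_mult_pois by (simp add: field_simps)
  have 2: "real k * stein l u k = stein_sum l u k / pois l k"
    using p unfolding stein_def by (cases "k = 0") (simp_all add: stein_sum_def)
  show ?thesis
    unfolding 1 2 using p by (simp add: stein_sum_def diff_divide_distrib[symmetric])
qed

lemma abs_stein_le:
  assumes l: "0 \<le> l" and u: "lip L u"
  shows "\<bar>stein l u k\<bar> \<le> L"
proof (cases "k = 0")
  case True
  then show ?thesis by (simp add: stein_def lip_nonneg[OF u])
next
  case False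
  show ?thesis
  proof (cases "l = 0")
    case True
    have "\<bar>u 0 - u k\<bar> \<le> L * real k"
      using u[unfolded lip_def, rule_format, of 0 k] by simp
    then show ?thesis
      using False by (simp add: stein_def True abs_div divide_le_eq)
  next
    case l0: False
    then have p: "0 < real k * pois l k"
      using l False by (simp add: pois_pos)
    then show ?thesis
      using abs_stein_sum_le[OF l u, of k] l0 by (simp add: stein_def divide_le_eq)
  qed
qed

text \<open>\<open>stein\<close> is linear in its function argument, the summability coming from the
  Lipschitz constant \<open>K\<close>. The difference of \<open>u\<close> and \<open>v\<close> is
  bounded by \<open>L\<close>, hence 2L-Lipschitz by \<open>lip_bounded\<close>, so
  \<open>abs_stein_le\<close> applies to it.\<close>

lemma abs_stein_diff_le:
  assumes l: "0 \<le> l" and u: "lip K u" and v: "lip K v" and uv: "\<And>k. \<bar>u k - v k\<bar> \<le> L"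
  shows "\<bar>stein l u k - stein l v k\<bar> \<le> 2 * L"
proof -
  have "stein l u k - stein l v k = stein l (\<lambda>k. u k + - v k) k"
    using stein_sum_add[OF l u lip_uminus[OF v], of k] stein_sum_uminus[OF l v, of k]
    by (simp add: stein_def diff_divide_distrib[symmetric])
  also have "\<bar>\<dots>\<bar> \<le> 2 * L"
    using uv by (intro abs_stein_le[OF l] lip_bounded) simp
  finally show ?thesis .
qed

section \<open>Laws on countable spaces\<close>

text \<open>Passes from an integral in \<open>poisson_step\<close> to the \<open>infsum\<close> of
  the theorem. For infinite \<open>A\<close>, each partial sum along an enumeration is a sum over a
  finite subset of \<open>A\<close>.\<close>

lemma nn_integral_count_space_le_infsum:
  fixes f :: "'b \<Rightarrow> ennreal"
  assumes "countable A"
  shows "(\<integral>\<^sup>+x. f x \<partial>count_space A) \<le> infsum f A"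
proof (cases "finite A")
  case True
  then show ?thesis by (simp add: nn_integral_count_space_finite)
next
  case False
  with assms have bij: "bij_betw (from_nat_into A) UNIV A"
    by (rule bij_betw_from_nat_into)
  have "(\<integral>\<^sup>+x. f x \<partial>count_space A) = (\<Sum>i. f (from_nat_into A i))"
    by (simp add: nn_integral_bij_count_space[OF bij, symmetric] nn_integral_count_space_nat)
  also have "\<dots> = (SUP k. \<Sum>i<k. f (from_nat_into A i))"
    by (rule suminf_eq_SUP)
  also have "\<dots> \<le> infsum f A"
  proof (rule SUP_least)
    fix k
    have "(\<Sum>i<k. f (from_nat_into A i)) = sum f (from_nat_into A ` {..<k})"
      by (rule sum.reindex_cong[symmetric, OF _ refl])
        (use bij in \<open>auto simp: bij_betw_def intro: inj_on_subset\<close>)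
    also have "\<dots> = infsum f (from_nat_into A ` {..<k})"
      by simp
    also have "\<dots> \<le> infsum f A"
      by (rule infsum_mono_neutral)
        (use bij in \<open>auto simp: bij_betw_def intro: nonneg_summable_on_complete\<close>)
    finally show "(\<Sum>i<k. f (from_nat_into A i)) \<le> infsum f A" .
  qed
  finally show ?thesis .
qed

lemma (in prob_space) distr_countable:
  fixes X :: "'a \<Rightarrow> 'b::countable"
  assumes [measurable]: "X \<in> M \<rightarrow>\<^sub>M count_space UNIV"
  shows "distr M (count_space UNIV) X =
    density (count_space UNIV) (\<lambda>x. ennreal (prob {\<omega> \<in> space M. X \<omega> = x}))"
proof (rule measure_eqI_countable[where A=UNIV])
  fix a
  have "emeasure (distr M (count_space UNIV) X) {a} = prob (X -` {a} \<inter> space M)"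
    by (simp add: emeasure_distr emeasure_eq_measure)
  moreover have "X -` {a} \<inter> space M = {\<omega> \<in> space M. X \<omega> = a}"
    by auto
  ultimately show "emeasure (distr M (count_space UNIV) X) {a} =
    emeasure (density (count_space UNIV) (\<lambda>x. ennreal (prob {\<omega> \<in> space M. X \<omega> = x}))) {a}"
    by (simp add: emeasure_density)
qed auto

lemma (in prob_space)
  fixes X :: "'a \<Rightarrow> 'b::countable" and \<phi> :: "'b \<Rightarrow> real"
  assumes [measurable]: "X \<in> M \<rightarrow>\<^sub>M count_space UNIV"
  shows integrable_countable_iff: "integrable M (\<lambda>\<omega>. \<phi> (X \<omega>)) \<longleftrightarrow>
      integrable (count_space UNIV) (\<lambda>x. prob {\<omega> \<in> space M. X \<omega> = x} * \<phi> x)"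
    and expectation_countable: "(\<integral>\<omega>. \<phi> (X \<omega>) \<partial>M) =
      (\<integral>x. prob {\<omega> \<in> space M. X \<omega> = x} * \<phi> x \<partial>count_space UNIV)"
proof -
  have "integrable M (\<lambda>\<omega>. \<phi> (X \<omega>)) \<longleftrightarrow> integrable (distr M (count_space UNIV) X) \<phi>"
    by (subst integrable_distr_eq) auto
  then show "integrable M (\<lambda>\<omega>. \<phi> (X \<omega>)) \<longleftrightarrow>
      integrable (count_space UNIV) (\<lambda>x. prob {\<omega> \<in> space M. X \<omega> = x} * \<phi> x)"
    by (simp add: distr_countable integrable_real_density)
  have "(\<integral>\<omega>. \<phi> (X \<omega>) \<partial>M) = integral\<^sup>L (distr M (count_space UNIV) X) \<phi>"
    by (subst integral_distr) auto
  then show "(\<integral>\<omega>. \<phi> (X \<omega>) \<partial>M) =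
      (\<integral>x. prob {\<omega> \<in> space M. X \<omega> = x} * \<phi> x \<partial>count_space UNIV)"
    by (simp add: distr_countable integral_real_density)
qed

lemma (in prob_space)
  assumes N: "N \<in> M \<rightarrow>\<^sub>M count_space UNIV"
    and law: "\<And>k. prob {\<omega> \<in> space M. N \<omega> = k} = pois l k"
    and l: "0 \<le> l" and u: "lip L u"
  shows integrable_pois_lip: "integrable M (\<lambda>\<omega>. u (N \<omega>))"
    and expectation_pois_lip: "(\<integral>\<omega>. u (N \<omega>) \<partial>M) = pois_mean l u"
proof -
  \<comment> \<open>Integrability over \<open>count_space\<close> means absolute summability, so
    \<open>summable_pois_lip\<close> is applied to the absolute value of \<open>u\<close>, which has
    the same Lipschitz constant.\<close>
  have "lip L (\<lambda>k. \<bar>u k\<bar>)"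
    using u unfolding lip_def by (meson abs_triangle_ineq3 order_trans)
  from summable_pois_lip[OF l this]
  have *: "integrable (count_space UNIV) (\<lambda>k. pois l k * u k)"
    by (simp add: integrable_count_space_nat_iff abs_mult pois_nonneg l mult.commute)
  then show "integrable M (\<lambda>\<omega>. u (N \<omega>))"
    by (simp add: integrable_countable_iff[OF N] law)
  show "(\<integral>\<omega>. u (N \<omega>) \<partial>M) = pois_mean l u"
    using integral_count_space_nat[OF *]
    by (simp add: expectation_countable[OF N] law pois_mean_def mult.commute)
qed

text \<open>A law on a countable space is determined by its singletons, so the product formula for
  point probabilities makes the joint law the product of the marginals. Then Fubini's theorem
  applies.\<close>

lemma (in prob_space) expectation_indep_countable:
  fixes X :: "'a \<Rightarrow> 'b::countable" and Y :: "'a \<Rightarrow> 'c::countable" and g :: "'b \<times> 'c \<Rightarrow> real"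
  assumes X[measurable]: "X \<in> M \<rightarrow>\<^sub>M count_space UNIV"
    and Y[measurable]: "Y \<in> M \<rightarrow>\<^sub>M count_space UNIV"
    and indep: "\<And>a b. prob {\<omega> \<in> space M. X \<omega> = a \<and> Y \<omega> = b} =
      prob {\<omega> \<in> space M. X \<omega> = a} * prob {\<omega> \<in> space M. Y \<omega> = b}"
    and int: "integrable M (\<lambda>\<omega>. g (X \<omega>, Y \<omega>))"
  shows "(\<integral>\<omega>. g (X \<omega>, Y \<omega>) \<partial>M) = (\<integral>\<omega>. (\<integral>\<omega>'. g (X \<omega>, Y \<omega>') \<partial>M) \<partial>M)"
proof -
  let ?X = "distr M (count_space UNIV) X" and ?Y = "distr M (count_space UNIV) Y"
  interpret X: prob_space ?X by (rule prob_space_distr) simp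
  interpret Y: prob_space ?Y by (rule prob_space_distr) simp
  interpret XY: pair_sigma_finite ?X ?Y ..
  have XY[measurable]: "(\<lambda>\<omega>. (X \<omega>, Y \<omega>)) \<in> M \<rightarrow>\<^sub>M count_space UNIV"
    using measurable_Pair[OF X Y] by (simp add: pair_measure_countable)
  have s: "sets (?X \<Otimes>\<^sub>M ?Y) = UNIV"
    by (subst sets_pair_countable[of UNIV UNIV]) auto
  have e: "distr M (count_space UNIV) (\<lambda>\<omega>. (X \<omega>, Y \<omega>)) = ?X \<Otimes>\<^sub>M ?Y"
  proof (rule measure_eqI_countable[where A=UNIV])
    fix ab :: "'b \<times> 'c"
    obtain a b where ab: "ab = (a, b)" by fastforce
    have "emeasure (?X \<Otimes>\<^sub>M ?Y) {ab} = emeasure (?X \<Otimes>\<^sub>M ?Y) ({a} \<times> {b})"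
      by (simp add: ab)
    also have "\<dots> = emeasure ?X {a} * emeasure ?Y {b}"
      by (rule Y.emeasure_pair_measure_Times) auto
    also have "\<dots> = ennreal (prob {\<omega> \<in> space M. X \<omega> = a} * prob {\<omega> \<in> space M. Y \<omega> = b})"
      by (simp add: distr_countable emeasure_density ennreal_mult)
    also have "\<dots> = emeasure (distr M (count_space UNIV) (\<lambda>\<omega>. (X \<omega>, Y \<omega>))) {ab}"
      by (simp add: distr_countable[OF XY] emeasure_density ab indep)
    finally show "emeasure (distr M (count_space UNIV) (\<lambda>\<omega>. (X \<omega>, Y \<omega>))) {ab} =
      emeasure (?X \<Otimes>\<^sub>M ?Y) {ab}" ..
  qed (auto simp: s)
  have "integrable (distr M (count_space UNIV) (\<lambda>\<omega>. (X \<omega>, Y \<omega>))) g"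
    using int by (subst integrable_distr_eq) auto
  then have "integral\<^sup>L (?X \<Otimes>\<^sub>M ?Y) g = (\<integral>x. (\<integral>y. g (x, y) \<partial>?Y) \<partial>?X)"
    by (simp add: XY.integral_fst' e)
  moreover have "(\<integral>\<omega>. g (X \<omega>, Y \<omega>) \<partial>M) = integral\<^sup>L (?X \<Otimes>\<^sub>M ?Y) g"
    unfolding e[symmetric] by (subst integral_distr) auto
  ultimately show ?thesis
    by (simp add: integral_distr)
qed

section \<open>Lipschitz functions of vectors and their Poisson averages\<close>

lemma sum_snoc_dist:
  assumes "length x = n" "length y = n"
  shows "(\<Sum>i<Suc n. \<bar>real ((x @ [j]) ! i) - real ((y @ [k]) ! i)\<bar>) =
    (\<Sum>i<n. \<bar>real (x ! i) - real (y ! i)\<bar>) + \<bar>real j - real k\<bar>"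
  using assms by (simp add: nth_append)

lemma lipschitz1D:
  "h \<in> lipschitz1 n \<Longrightarrow> length x = n \<Longrightarrow> length y = n \<Longrightarrow>
    \<bar>h x - h y\<bar> \<le> (\<Sum>i<n. \<bar>real (x ! i) - real (y ! i)\<bar>)"
  by (simp add: lipschitz1_def)

lemma lipschitz1_snocD:
  assumes "h \<in> lipschitz1 (Suc n)" "length x = n" "length y = n"
  shows "\<bar>h (x @ [j]) - h (y @ [k])\<bar> \<le> (\<Sum>i<n. \<bar>real (x ! i) - real (y ! i)\<bar>) + \<bar>real j - real k\<bar>"
  using lipschitz1D[OF assms(1), of "x @ [j]" "y @ [k]"] assms(2,3)
  by (simp only: sum_snoc_dist) simp

lemma lip_snoc:
  assumes "h \<in> lipschitz1 (Suc n)" "length x = n"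
  shows "lip 1 (\<lambda>k. h (x @ [k]))"
  using lipschitz1_snocD[OF assms(1,2,2)] by (simp add: lip_def)

text \<open>For each fixed last entry \<open>k\<close>, moving from \<open>x\<close> to
  \<open>y\<close> costs at most their distance. The Poisson mean is monotone and fixes constants,
  so it keeps this bound.\<close>

lemma lipschitz1_pois_mean:
  assumes h: "h \<in> lipschitz1 (Suc n)" and l: "0 \<le> l"
  shows "(\<lambda>x. pois_mean l (\<lambda>k. h (x @ [k]))) \<in> lipschitz1 n"
proof -
  have *: "pois_mean l (\<lambda>k. h (x @ [k])) \<le>
      pois_mean l (\<lambda>k. h (y @ [k])) + (\<Sum>i<n. \<bar>real (x ! i) - real (y ! i)\<bar>)" (is "_ \<le> _ + ?D")
    if xy: "length x = n" "length y = n" for x y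
  proof -
    have c: "lip 0 (\<lambda>k. ?D)" by (simp add: lip_def)
    note lx = lip_snoc[OF h xy(1)] and ly = lip_snoc[OF h xy(2)]
    have "pois_mean l (\<lambda>k. h (x @ [k])) \<le> pois_mean l (\<lambda>k. h (y @ [k]) + ?D)"
      using lipschitz1_snocD[OF h xy, of k k for k]
      by (intro pois_mean_mono[OF l lx lip_add[OF ly c]]) (simp add: abs_le_iff algebra_simps)
    also have "\<dots> = pois_mean l (\<lambda>k. h (y @ [k])) + ?D"
      by (simp add: pois_mean_add[OF l ly c] pois_mean_const)
    finally show ?thesis .
  qed
  show ?thesis
    unfolding lipschitz1_def
  proof (intro CollectI allI impI)
    fix x y :: "nat list" assume "length x = n" "length y = n"
    then show "\<bar>pois_mean l (\<lambda>k. h (x @ [k])) - pois_mean l (\<lambda>k. h (y @ [k]))\<bar> \<le>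
      (\<Sum>i<n. \<bar>real (x ! i) - real (y ! i)\<bar>)"
      using *[of x y] *[of y x] by (simp add: abs_minus_commute abs_le_iff)
  qed
qed

text \<open>The values of \<open>h\<close> are dominated by
  \<open>\<bar>h (replicate n 0)\<bar>\<close> plus the sum of the entries.\<close>

lemma (in prob_space) integrable_lipschitz1:
  assumes N[measurable]: "N \<in> M \<rightarrow>\<^sub>M count_space UNIV"
    and len: "\<And>\<omega>. \<omega> \<in> space M \<Longrightarrow> length (N \<omega>) = n"
    and int: "\<And>i. i < n \<Longrightarrow> integrable M (\<lambda>\<omega>. real (N \<omega> ! i))"
    and h: "h \<in> lipschitz1 n"
  shows "integrable M (\<lambda>\<omega>. h (N \<omega>))"
proof (rule Bochner_Integration.integrable_bound)
  show "integrable M (\<lambda>\<omega>. \<bar>h (replicate n 0)\<bar> + (\<Sum>i<n. real (N \<omega> ! i)))"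
    using int by (intro Bochner_Integration.integrable_add Bochner_Integration.integrable_sum) auto
  show "AE \<omega> in M. norm (h (N \<omega>)) \<le> norm (\<bar>h (replicate n 0)\<bar> + (\<Sum>i<n. real (N \<omega> ! i)))"
  proof (rule AE_I2)
    fix \<omega> assume "\<omega> \<in> space M"
    from lipschitz1D[OF h len[OF this], of "replicate n 0"]
    have "\<bar>h (N \<omega>) - h (replicate n 0)\<bar> \<le> (\<Sum>i<n. real (N \<omega> ! i))"
      by simp
    then show "norm (h (N \<omega>)) \<le> norm (\<bar>h (replicate n 0)\<bar> + (\<Sum>i<n. real (N \<omega> ! i)))"
      unfolding real_norm_def by linarith
  qed
qed simp

text \<open>The mean of \<open>g\<close> when the coordinates after the prefix \<open>x\<close> are
  independent Poisson variables with rates \<open>ls\<close>;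
  \<open>expectation_poisson_counts\<close> identifies it as such.\<close>

fun hybrid :: "real list \<Rightarrow> (nat list \<Rightarrow> real) \<Rightarrow> nat list \<Rightarrow> real" where
  "hybrid [] g x = g x"
| "hybrid (l # ls) g x = pois_mean l (\<lambda>k. hybrid ls g (x @ [k]))"

lemma lipschitz1_hybrid:
  assumes "g \<in> lipschitz1 (n + length ls)" "\<And>l. l \<in> set ls \<Longrightarrow> 0 \<le> l"
  shows "hybrid ls g \<in> lipschitz1 n"
  using assms
proof (induction ls arbitrary: n)
  case Nil
  then show ?case by (simp add: lipschitz1_def)
next
  case (Cons l ls)
  then have "hybrid ls g \<in> lipschitz1 (Suc n)"
    by (intro Cons.IH) auto
  from lipschitz1_pois_mean[OF this, of l] Cons.prems(2)
  show ?case
    by (simp add: lipschitz1_def)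
qed

section \<open>Replacing one count by a Poisson variable\<close>

definition stein_list :: "real \<Rightarrow> (nat list \<Rightarrow> real) \<Rightarrow> nat list \<Rightarrow> real" where
  "stein_list l h m = stein l (\<lambda>k. h (butlast m @ [k])) (last m)"

lemma length_Suc_snoc: "length m = Suc n \<Longrightarrow> \<exists>x k. m = x @ [k] \<and> length x = n"
  by (metis append_butlast_last_id diff_Suc_1 length_0_conv length_butlast nat.distinct(1))

lemma stein_list_equation:
  assumes "0 \<le> l"
  shows "l * stein_list l h (x @ [Suc k]) - real k * stein_list l h (x @ [k]) =
    h (x @ [k]) - pois_mean l (\<lambda>k. h (x @ [k]))"
  using stein_equation[OF assms, of "\<lambda>k. h (x @ [k])" k] by (simp add: stein_list_def)

lemma abs_stein_list_le:
  assumes "0 \<le> l" "h \<in> lipschitz1 (Suc n)" "length m = Suc n"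
  shows "\<bar>stein_list l h m\<bar> \<le> 1"
  using abs_stein_le[OF assms(1) lip_snoc[OF assms(2)]] assms(3) by (simp add: stein_list_def)

text \<open>The path from \<open>x @ [j]\<close> to \<open>y @ [k]\<close> has two legs. Replacing
  \<open>x\<close> by \<open>y\<close> changes the right-hand function of the Stein equation by at
  most their distance; replacing \<open>j\<close> by \<open>k\<close> uses that a solution is
  bounded by 1. Each factor 2 comes from \<open>lip_bounded\<close>.\<close>

lemma abs_stein_list_diff_le:
  assumes l: "0 \<le> l" and h: "h \<in> lipschitz1 (Suc n)" and x: "length x = n" and y: "length y = n"
  shows "\<bar>stein_list l h (x @ [j]) - stein_list l h (y @ [k])\<bar> \<le>
    2 * ((\<Sum>i<n. \<bar>real (x ! i) - real (y ! i)\<bar>) + \<bar>real j - real k\<bar>)"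
proof -
  let ?s = "\<lambda>x. stein l (\<lambda>k. h (x @ [k]))"
  have "\<bar>?s x j - ?s y j\<bar> \<le> 2 * (\<Sum>i<n. \<bar>real (x ! i) - real (y ! i)\<bar>)"
    using lipschitz1_snocD[OF h x y, of k k for k]
    by (intro abs_stein_diff_le[OF l lip_snoc[OF h x] lip_snoc[OF h y]]) simp
  moreover have "\<bar>?s y j - ?s y k\<bar> \<le> 2 * \<bar>real j - real k\<bar>"
    using lip_bounded[of "?s y" 1, OF abs_stein_le[OF l lip_snoc[OF h y]]] by (simp add: lip_def)
  ultimately show ?thesis
    unfolding stein_list_def by simp
qed

text \<open>
  The event \<open>N + Z = (m\<^sub>1, \<dots>, m\<^sub>i\<^sub>-\<^sub>1, m\<^sub>i - 1)\<close> becomes \<open>shift_add N Z = m\<close>;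
  sums with a negative component are sent to the dummy value \<open>[]\<close>.
\<close>

definition shift_add :: "nat list \<Rightarrow> int list \<Rightarrow> nat list" where
  "shift_add m z = (let w = map2 (+) (map int m) z in
     if \<forall>a\<in>set w. 0 \<le> a then map nat (butlast w) @ [Suc (nat (last w))] else [])"

text \<open>As the last entry of \<open>m'\<close> is nonzero, its decrement undoes the increment in
  \<open>shift_add\<close>. An integer vector comes from natural numbers exactly when its entries
  are nonnegative, and the dummy \<open>[]\<close> never has the length of
  \<open>m'\<close>.\<close>

lemma shift_add_eq_iff:
  assumes "length m = Suc n" "length z = Suc n" "length m' = Suc n" "last m' \<noteq> 0"
  shows "shift_add m z = m' \<longleftrightarrow> map2 (+) (map int m) z = map int (butlast m' @ [last m' - 1])"
proof -
  define w where "w = map2 (+) (map int m) z"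
  have "length w = Suc n" using assms by (simp add: w_def)
  then obtain v b where w: "w = v @ [b]" "length v = n" using length_Suc_snoc by blast
  obtain x k where m': "m' = x @ [k]" "length x = n" using length_Suc_snoc[OF assms(3)] by blast
  have v: "v = map int x \<longleftrightarrow> map nat v = x" if "\<forall>a\<in>set v. 0 \<le> a"
  proof
    assume "map nat v = x"
    then have "map int x = map (\<lambda>a. int (nat a)) v" by auto
    also have "\<dots> = v" using that by (intro map_idI) auto
    finally show "v = map int x" ..
  qed (auto simp: comp_def)
  have "shift_add m z = m' \<longleftrightarrow> (\<forall>a\<in>set v. 0 \<le> a) \<and> 0 \<le> b \<and> map nat v = x \<and> Suc (nat b) = k"
    unfolding shift_add_def Let_def w_def[symmetric] w m' using assms(4) m' by auto
  also have "\<dots> \<longleftrightarrow> v = map int x \<and> b = int (k - 1)"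
    using v assms(4) m' by auto
  finally show ?thesis
    unfolding w_def[symmetric] w m' by simp
qed

text \<open>If the sum of \<open>m\<close> and \<open>z\<close> has no negative entry, the two
  arguments differ exactly by \<open>z\<close> and the 2-Lipschitz bound applies. Otherwise only the
  first term is left, which is at most 1, while a negative entry forces some component of
  \<open>z\<close> to have modulus at least 1.\<close>

lemma stein_list_shift_add:
  assumes l: "0 \<le> l" and h: "h \<in> lipschitz1 (Suc n)"
    and m: "length m = Suc n" and z: "length z = Suc n"
  shows "\<bar>stein_list l h (butlast m @ [Suc (last m)]) -
      (if shift_add m z = [] then 0 else stein_list l h (shift_add m z))\<bar> \<le>
    2 * (\<Sum>j<Suc n. \<bar>real_of_int (z ! j)\<bar>)"
proof -
  define w where "w = map2 (+) (map int m) z"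
  have lw: "length w = Suc n" using assms by (simp add: w_def)
  have wi: "w ! j = int (m ! j) + z ! j" if "j < Suc n" for j
    using that m z by (simp add: w_def)
  show ?thesis
  proof (cases "\<forall>a\<in>set w. 0 \<le> a")
    case True
    obtain x k where m': "m = x @ [k]" "length x = n" using length_Suc_snoc[OF m] by blast
    obtain v b where w: "w = v @ [b]" "length v = n" using length_Suc_snoc[OF lw] by blast
    have s: "shift_add m z = map nat v @ [Suc (nat b)]"
      unfolding shift_add_def Let_def w_def[symmetric] using True w by simp
    have v: "real (x ! i) - real (map nat v ! i) = - real_of_int (z ! i)" if "i < n" for i
    proof -
      have "v ! i \<in> set w" using that by (simp add: w)
      with True have "0 \<le> v ! i" by blast
      moreover have "v ! i = int (x ! i) + z ! i"
        using that wi[of i] by (simp add: w m' nth_append)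
      ultimately show ?thesis using that w by simp
    qed
    have b: "real k - real (nat b) = - real_of_int (z ! n)"
      using True wi[of n] by (simp add: w m' nth_append)
    have "\<bar>stein_list l h (x @ [Suc k]) - stein_list l h (map nat v @ [Suc (nat b)])\<bar> \<le>
      2 * ((\<Sum>i<n. \<bar>real (x ! i) - real (map nat v ! i)\<bar>) + \<bar>real (Suc k) - real (Suc (nat b))\<bar>)"
      using w m' by (intro abs_stein_list_diff_le[OF l h]) auto
    also have "(\<Sum>i<n. \<bar>real (x ! i) - real (map nat v ! i)\<bar>) = (\<Sum>i<n. \<bar>real_of_int (z ! i)\<bar>)"
      by (intro sum.cong refl) (simp only: v lessThan_iff abs_minus_cancel)
    also have "\<bar>real (Suc k) - real (Suc (nat b))\<bar> = \<bar>real_of_int (z ! n)\<bar>"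
      using b by simp
    finally show ?thesis
      unfolding s by (simp add: m')
  next
    case False
    then obtain j where j: "j < Suc n" "w ! j < 0"
      using lw by (metis in_set_conv_nth not_le)
    then have "1 \<le> \<bar>real_of_int (z ! j)\<bar>"
      using wi[of j] by linarith
    also have "\<dots> \<le> (\<Sum>j<Suc n. \<bar>real_of_int (z ! j)\<bar>)"
      using j by (intro member_le_sum) auto
    finally have "1 \<le> (\<Sum>j<Suc n. \<bar>real_of_int (z ! j)\<bar>)" .
    moreover have "shift_add m z = []"
      unfolding shift_add_def Let_def w_def[symmetric] using False by auto
    moreover have "\<bar>stein_list l h (butlast m @ [Suc (last m)])\<bar> \<le> 1"
      using m by (intro abs_stein_list_le[OF l h]) simp
    ultimately show ?thesis by simp
  qed
qed

text \<open>Stated for a random vector \<open>N\<close> of natural numbers, without point processes.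
  With \<open>N\<close> the counts of a prefix of the tuple and \<open>l\<close> the intensity of
  its last set, \<open>q\<close> becomes \<open>q_coeff\<close>.\<close>

lemma (in prob_space) poisson_step:
  fixes N :: "'a \<Rightarrow> nat list" and Z :: "'a \<Rightarrow> int list" and l :: real
  defines "q \<equiv> \<lambda>m. real (last m) * prob {\<omega> \<in> space M. N \<omega> = m} -
    l * prob {\<omega> \<in> space M. map2 (+) (map int (N \<omega>)) (Z \<omega>) = map int (butlast m @ [last m - 1])}"
  assumes N[measurable]: "N \<in> M \<rightarrow>\<^sub>M count_space UNIV"
    and lenN: "\<And>\<omega>. \<omega> \<in> space M \<Longrightarrow> length (N \<omega>) = Suc n"
    and int: "\<And>i. i < Suc n \<Longrightarrow> integrable M (\<lambda>\<omega>. real (N \<omega> ! i))"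
    and Z: "Z \<in> M \<rightarrow>\<^sub>M count_space {z. length z = Suc n}"
    and l: "0 \<le> l" and h: "h \<in> lipschitz1 (Suc n)"
  shows "ennreal \<bar>(\<integral>\<omega>. h (N \<omega>) \<partial>M) - (\<integral>\<omega>. pois_mean l (\<lambda>k. h (butlast (N \<omega>) @ [k])) \<partial>M)\<bar> \<le>
    (\<Sum>\<^sub>\<infinity>m\<in>{m. length m = Suc n \<and> last m \<noteq> 0}. ennreal \<bar>q m\<bar>) +
    2 * ennreal l * (\<Sum>j<Suc n. \<integral>\<^sup>+ \<omega>. ennreal \<bar>real_of_int (Z \<omega> ! j)\<bar> \<partial>M)"
proof -
  define I where "I = {m :: nat list. length m = Suc n \<and> last m \<noteq> 0}"
  \<comment> \<open>The cutoff gives the dummy \<open>[]\<close> the value 0. It changes nothing on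
    vectors of length \<open>Suc n\<close> with last entry 0, where \<open>stein\<close> is 0
    anyway.\<close>
  define \<phi> where "\<phi> m = (if m \<in> I then stein_list l h m else 0)" for m
  \<comment> \<open>With e the last unit vector, \<open>W\<close> is N + Z + e, or \<open>[]\<close>
    if N + Z has a negative component, and \<open>T\<close> is N + e.\<close>
  define W where "W \<omega> = shift_add (N \<omega>) (Z \<omega>)" for \<omega>
  define T where "T \<omega> = butlast (N \<omega>) @ [Suc (last (N \<omega>))]" for \<omega>
  have Z'[measurable]: "Z \<in> M \<rightarrow>\<^sub>M count_space UNIV"
    by (rule measurable_compose[OF Z, of "\<lambda>z. z"]) simp
  have lenZ: "length (Z \<omega>) = Suc n" if "\<omega> \<in> space M" for \<omega>
    using measurable_space[OF Z that] by simp
  have W[measurable]: "W \<in> M \<rightarrow>\<^sub>M count_space UNIV"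
    unfolding W_def
    by (rule measurable_compose_countable[OF measurable_compose[OF Z' measurable_count_space] N])
  have T[measurable]: "T \<in> M \<rightarrow>\<^sub>M count_space UNIV"
    unfolding T_def by (rule measurable_compose[OF N measurable_count_space])
  have \<phi>1: "\<bar>\<phi> m\<bar> \<le> 1" for m
    using abs_stein_list_le[OF l h] by (simp add: \<phi>_def I_def)
  have int_last: "integrable M (\<lambda>\<omega>. real (last (N \<omega>)))"
  proof (rule Bochner_Integration.integrable_cong[THEN iffD1, OF refl _ int[of n]])
    fix \<omega> assume "\<omega> \<in> space M"
    then show "real (N \<omega> ! n) = real (last (N \<omega>))"
      using lenN[of \<omega>] by (metis diff_Suc_1 last_conv_nth length_0_conv nat.distinct(1))
  qed simp
  have int_N: "integrable M (\<lambda>\<omega>. real (last (N \<omega>)) * \<phi> (N \<omega>))"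
  proof (rule Bochner_Integration.integrable_bound[OF int_last])
    show "AE \<omega> in M. norm (real (last (N \<omega>)) * \<phi> (N \<omega>)) \<le> norm (real (last (N \<omega>)))"
      using \<phi>1 by (intro AE_I2) (simp add: abs_mult mult_left_le)
  qed simp
  have int_W: "integrable M (\<lambda>\<omega>. \<phi> (W \<omega>))" and int_T: "integrable M (\<lambda>\<omega>. \<phi> (T \<omega>))"
    using \<phi>1 by (auto intro!: integrable_const_bound[where B=1])
  have int_h: "integrable M (\<lambda>\<omega>. h (N \<omega>))"
    by (rule integrable_lipschitz1[OF N lenN int h])
  have stein_N: "h (N \<omega>) - pois_mean l (\<lambda>k. h (butlast (N \<omega>) @ [k])) =
      l * \<phi> (T \<omega>) - real (last (N \<omega>)) * \<phi> (N \<omega>)" if \<omega>: "\<omega> \<in> space M" for \<omega>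
  proof -
    obtain x k where x: "N \<omega> = x @ [k]" "length x = n"
      using length_Suc_snoc[OF lenN[OF \<omega>]] by blast
    have "\<phi> (T \<omega>) = stein_list l h (x @ [Suc k])"
      by (simp add: \<phi>_def T_def x I_def)
    moreover have "real (last (N \<omega>)) * \<phi> (N \<omega>) = real k * stein_list l h (x @ [k])"
      by (simp add: \<phi>_def x I_def)
    ultimately show ?thesis
      using stein_list_equation[OF l, of h x k] unfolding x(1) butlast_snoc last_snoc by (simp only:)
  qed
  \<comment> \<open>By the Stein equation this function is a combination of functions already known
    to be integrable.\<close>
  have int_m: "integrable M (\<lambda>\<omega>. pois_mean l (\<lambda>k. h (butlast (N \<omega>) @ [k])))"
  proof (rule Bochner_Integration.integrable_cong[THEN iffD1, OF refl])
    show "integrable M (\<lambda>\<omega>. h (N \<omega>) - (l * \<phi> (T \<omega>) - real (last (N \<omega>)) * \<phi> (N \<omega>)))"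
      by (intro Bochner_Integration.integrable_diff integrable_mult_right int_h int_T int_N)
    show "h (N \<omega>) - (l * \<phi> (T \<omega>) - real (last (N \<omega>)) * \<phi> (N \<omega>)) =
        pois_mean l (\<lambda>k. h (butlast (N \<omega>) @ [k]))" if "\<omega> \<in> space M" for \<omega>
      using stein_N[OF that] by simp
  qed
  have "(\<integral>\<omega>. h (N \<omega>) \<partial>M) - (\<integral>\<omega>. pois_mean l (\<lambda>k. h (butlast (N \<omega>) @ [k])) \<partial>M) =
      (\<integral>\<omega>. l * \<phi> (T \<omega>) - real (last (N \<omega>)) * \<phi> (N \<omega>) \<partial>M)"
    unfolding Bochner_Integration.integral_diff[OF int_h int_m, symmetric]
    by (rule Bochner_Integration.integral_cong[OF refl stein_N])
  \<comment> \<open>The mean of \<open>\<phi> (W \<omega>)\<close> is subtracted and added: the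
    first part is controlled by the size of \<open>Z\<close>, the second by
    \<open>q\<close>.\<close>
  also have "\<dots> = l * (\<integral>\<omega>. \<phi> (T \<omega>) - \<phi> (W \<omega>) \<partial>M) +
      (l * (\<integral>\<omega>. \<phi> (W \<omega>) \<partial>M) - (\<integral>\<omega>. real (last (N \<omega>)) * \<phi> (N \<omega>) \<partial>M))"
    using int_T int_W int_N by (simp add: algebra_simps)
  finally have split: "(\<integral>\<omega>. h (N \<omega>) \<partial>M) - (\<integral>\<omega>. pois_mean l (\<lambda>k. h (butlast (N \<omega>) @ [k])) \<partial>M) =
      l * (\<integral>\<omega>. \<phi> (T \<omega>) - \<phi> (W \<omega>) \<partial>M) +
      (l * (\<integral>\<omega>. \<phi> (W \<omega>) \<partial>M) - (\<integral>\<omega>. real (last (N \<omega>)) * \<phi> (N \<omega>) \<partial>M))" .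

  \<comment> \<open>Bounding in \<open>ennreal\<close> allows the mean modulus of a component of
    \<open>Z\<close> to be infinite.\<close>
  have "ennreal \<bar>\<integral>\<omega>. \<phi> (T \<omega>) - \<phi> (W \<omega>) \<partial>M\<bar> \<le> (\<integral>\<^sup>+\<omega>. ennreal \<bar>\<phi> (T \<omega>) - \<phi> (W \<omega>)\<bar> \<partial>M)"
    using integral_norm_bound_ennreal[OF Bochner_Integration.integrable_diff[OF int_T int_W]] by simp
  also have "\<dots> \<le> (\<integral>\<^sup>+\<omega>. 2 * (\<Sum>j<Suc n. ennreal \<bar>real_of_int (Z \<omega> ! j)\<bar>) \<partial>M)"
  proof (rule nn_integral_mono)
    fix \<omega> assume \<omega>: "\<omega> \<in> space M"
    have "\<phi> (T \<omega>) = stein_list l h (butlast (N \<omega>) @ [Suc (last (N \<omega>))])"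
      using lenN[OF \<omega>] by (simp add: \<phi>_def T_def I_def)
    \<comment> \<open>A value of \<open>shift_add\<close> other than \<open>[]\<close> ends in a
      successor, so it lies in \<open>I\<close>.\<close>
    moreover have "\<phi> (W \<omega>) = (if W \<omega> = [] then 0 else stein_list l h (W \<omega>))"
      using lenN[OF \<omega>] lenZ[OF \<omega>] by (auto simp: \<phi>_def W_def I_def shift_add_def Let_def)
    ultimately have "\<bar>\<phi> (T \<omega>) - \<phi> (W \<omega>)\<bar> \<le> 2 * (\<Sum>j<Suc n. \<bar>real_of_int (Z \<omega> ! j)\<bar>)"
      using stein_list_shift_add[OF l h lenN[OF \<omega>] lenZ[OF \<omega>]]
      unfolding W_def by (simp only:)
    then have "ennreal \<bar>\<phi> (T \<omega>) - \<phi> (W \<omega>)\<bar> \<le> ennreal (2 * (\<Sum>j<Suc n. \<bar>real_of_int (Z \<omega> ! j)\<bar>))"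
      by (rule ennreal_leI)
    also have "\<dots> = 2 * (\<Sum>j<Suc n. ennreal \<bar>real_of_int (Z \<omega> ! j)\<bar>)"
      by (subst sum_ennreal) (auto simp: ennreal_mult sum_nonneg)
    finally show "ennreal \<bar>\<phi> (T \<omega>) - \<phi> (W \<omega>)\<bar> \<le> 2 * (\<Sum>j<Suc n. ennreal \<bar>real_of_int (Z \<omega> ! j)\<bar>)" .
  qed
  also have "\<dots> = 2 * (\<Sum>j<Suc n. \<integral>\<^sup>+\<omega>. ennreal \<bar>real_of_int (Z \<omega> ! j)\<bar> \<partial>M)"
  proof -
    have [measurable]: "(\<lambda>\<omega>. ennreal \<bar>real_of_int (Z \<omega> ! j)\<bar>) \<in> borel_measurable M" for j
      by (rule measurable_compose[OF Z']) simp
    show ?thesis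
      by (subst nn_integral_cmult, measurable, subst nn_integral_sum, measurable)
  qed
  finally have "ennreal l * ennreal \<bar>\<integral>\<omega>. \<phi> (T \<omega>) - \<phi> (W \<omega>) \<partial>M\<bar> \<le>
      ennreal l * (2 * (\<Sum>j<Suc n. \<integral>\<^sup>+\<omega>. ennreal \<bar>real_of_int (Z \<omega> ! j)\<bar> \<partial>M))"
    by (rule mult_left_mono) simp
  then have TW: "ennreal \<bar>l * (\<integral>\<omega>. \<phi> (T \<omega>) - \<phi> (W \<omega>) \<partial>M)\<bar> \<le>
      2 * ennreal l * (\<Sum>j<Suc n. \<integral>\<^sup>+\<omega>. ennreal \<bar>real_of_int (Z \<omega> ! j)\<bar> \<partial>M)"
    using l by (simp add: abs_mult ennreal_mult mult_ac)

  have iW: "integrable (count_space UNIV) (\<lambda>m. prob {\<omega> \<in> space M. W \<omega> = m} * \<phi> m)"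
    using int_W by (simp add: integrable_countable_iff[OF W])
  have iN: "integrable (count_space UNIV) (\<lambda>m. prob {\<omega> \<in> space M. N \<omega> = m} * (real (last m) * \<phi> m))"
    using int_N by (subst integrable_countable_iff[OF N, symmetric]) simp
  have "l * (\<integral>\<omega>. \<phi> (W \<omega>) \<partial>M) - (\<integral>\<omega>. real (last (N \<omega>)) * \<phi> (N \<omega>) \<partial>M) =
      (\<integral>m. l * (prob {\<omega> \<in> space M. W \<omega> = m} * \<phi> m) -
        prob {\<omega> \<in> space M. N \<omega> = m} * (real (last m) * \<phi> m) \<partial>count_space UNIV)"
    unfolding Bochner_Integration.integral_diff[OF integrable_mult_right[OF iW] iN]
    by (simp add: expectation_countable[OF W] expectation_countable[OF N, of "\<lambda>m. real (last m) * \<phi> m"])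
  also have "(\<lambda>m. l * (prob {\<omega> \<in> space M. W \<omega> = m} * \<phi> m) -
      prob {\<omega> \<in> space M. N \<omega> = m} * (real (last m) * \<phi> m)) = (\<lambda>m. - q m * \<phi> m)"
  proof
    fix m
    \<comment> \<open>On \<open>I\<close> the event that \<open>W\<close> equals \<open>m\<close> is
      the one in \<open>q\<close>; off \<open>I\<close> the factor \<open>\<phi> m\<close> is
      0.\<close>
    have "prob {\<omega> \<in> space M. W \<omega> = m} = prob {\<omega> \<in> space M.
        map2 (+) (map int (N \<omega>)) (Z \<omega>) = map int (butlast m @ [last m - 1])}" if "m \<in> I"
      using that lenN lenZ unfolding W_def I_def
      by (intro arg_cong[where f=prob] Collect_cong conj_cong refl shift_add_eq_iff) auto
    then show "l * (prob {\<omega> \<in> space M. W \<omega> = m} * \<phi> m) -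
      prob {\<omega> \<in> space M. N \<omega> = m} * (real (last m) * \<phi> m) = - q m * \<phi> m"
      by (cases "m \<in> I") (simp_all add: q_def \<phi>_def algebra_simps)
  qed
  finally have e: "l * (\<integral>\<omega>. \<phi> (W \<omega>) \<partial>M) - (\<integral>\<omega>. real (last (N \<omega>)) * \<phi> (N \<omega>) \<partial>M) =
      (\<integral>m. - q m * \<phi> m \<partial>count_space UNIV)" .
  have "ennreal \<bar>\<integral>m. - q m * \<phi> m \<partial>count_space UNIV\<bar> \<le> (\<integral>\<^sup>+m. ennreal \<bar>- q m * \<phi> m\<bar> \<partial>count_space UNIV)"
  \<comment> \<open>A non-integrable function has integral 0 by convention, which makes the bound
    trivial.\<close>
  proof (cases "integrable (count_space UNIV) (\<lambda>m. - q m * \<phi> m)")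
    case True
    from integral_norm_bound_ennreal[OF this] show ?thesis by simp
  next
    case False
    show ?thesis unfolding not_integrable_integral_eq[OF False] by simp
  qed
  also have "\<dots> \<le> (\<integral>\<^sup>+m. ennreal \<bar>q m\<bar> * indicator I m \<partial>count_space UNIV)"
  proof (rule nn_integral_mono)
    fix m
    show "ennreal \<bar>- q m * \<phi> m\<bar> \<le> ennreal \<bar>q m\<bar> * indicator I m"
    proof (cases "m \<in> I")
      case True
      then show ?thesis
        using \<phi>1[of m] by (simp add: abs_mult mult_left_le)
    qed (simp add: \<phi>_def)
  qed
  also have "\<dots> = (\<integral>\<^sup>+m. ennreal \<bar>q m\<bar> \<partial>count_space I)"
    by (simp add: nn_integral_count_space_indicator)
  also have "\<dots> \<le> (\<Sum>\<^sub>\<infinity>m\<in>I. ennreal \<bar>q m\<bar>)"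
    by (rule nn_integral_count_space_le_infsum) simp
  finally have WN: "ennreal \<bar>l * (\<integral>\<omega>. \<phi> (W \<omega>) \<partial>M) - (\<integral>\<omega>. real (last (N \<omega>)) * \<phi> (N \<omega>) \<partial>M)\<bar> \<le>
      (\<Sum>\<^sub>\<infinity>m\<in>I. ennreal \<bar>q m\<bar>)"
    unfolding e .
  have "ennreal \<bar>(\<integral>\<omega>. h (N \<omega>) \<partial>M) - (\<integral>\<omega>. pois_mean l (\<lambda>k. h (butlast (N \<omega>) @ [k])) \<partial>M)\<bar> \<le>
      ennreal \<bar>l * (\<integral>\<omega>. \<phi> (W \<omega>) \<partial>M) - (\<integral>\<omega>. real (last (N \<omega>)) * \<phi> (N \<omega>) \<partial>M)\<bar> +
      ennreal \<bar>l * (\<integral>\<omega>. \<phi> (T \<omega>) - \<phi> (W \<omega>) \<partial>M)\<bar>"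
    unfolding split ennreal_plus[OF abs_ge_zero abs_ge_zero, symmetric] by (rule ennreal_leI) linarith
  also note add_mono[OF WN TW]
  finally show ?thesis
    unfolding I_def .
qed

section \<open>Counts of point processes\<close>

lemma point_process_space:
  assumes "point_process P X \<xi>" "\<omega> \<in> space P"
  shows "\<xi> \<omega> \<in> counting_measures X"
proof -
  have "space (counting_measure_space X) = counting_measures X"
    unfolding counting_measure_space_def by (rule space_measure_of) auto
  then show ?thesis
    using assms measurable_space[of \<xi> P "counting_measure_space X"] by (simp add: point_process_def)
qed

text \<open>The preimages of Borel sets under evaluation at \<open>B\<close> are among the
  generators of \<open>counting_measure_space X\<close>.\<close>

lemma measurable_emeasure_point_process:
  assumes \<xi>: "point_process P X \<xi>" and B: "B \<in> sets X"
  shows "(\<lambda>\<omega>. emeasure (\<xi> \<omega>) B) \<in> borel_measurable P"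
proof (rule measurableI)
  fix U :: "ennreal set" assume U: "U \<in> sets borel"
  have "{\<nu> \<in> counting_measures X. emeasure \<nu> B \<in> U} \<in> sets (counting_measure_space X)"
    unfolding counting_measure_space_def using B U by (subst sets_measure_of) auto
  with \<xi> have "\<xi> -` {\<nu> \<in> counting_measures X. emeasure \<nu> B \<in> U} \<inter> space P \<in> sets P"
    unfolding point_process_def by (blast intro: measurable_sets)
  also have "\<xi> -` {\<nu> \<in> counting_measures X. emeasure \<nu> B \<in> U} \<inter> space P =
      (\<lambda>\<omega>. emeasure (\<xi> \<omega>) B) -` U \<inter> space P"
    using point_process_space[OF \<xi>] by auto
  finally show "(\<lambda>\<omega>. emeasure (\<xi> \<omega>) B) -` U \<inter> space P \<in> sets P" .
qed simp

lemma measurable_count_point_process: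
  assumes "point_process P X \<xi>" "B \<in> sets X"
  shows "(\<lambda>\<omega>. nat \<lfloor>measure (\<xi> \<omega>) B\<rfloor>) \<in> P \<rightarrow>\<^sub>M count_space UNIV"
proof -
  note [measurable] = measurable_emeasure_point_process[OF assms]
  show ?thesis unfolding measure_def by measurable
qed

lemma measurable_counts:
  assumes "point_process P X \<xi>" "set A \<subseteq> sets X"
  shows "(\<lambda>\<omega>. counts (\<xi> \<omega>) A) \<in> P \<rightarrow>\<^sub>M count_space UNIV"
  using assms(2)
proof (induction A)
  case (Cons B A)
  have "(\<lambda>\<omega>. k # counts (\<xi> \<omega>) A) \<in> P \<rightarrow>\<^sub>M count_space UNIV" for k
    using Cons by (intro measurable_compose[OF Cons.IH measurable_count_space]) auto
  from measurable_compose_countable[OF this measurable_count_point_process[OF assms(1), of B]]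
  show ?case
    using Cons.prems by (simp add: counts_def)
qed (simp add: counts_def)

text \<open>\<open>intensity_measure\<close> is built by \<open>measure_of\<close>, so its value at
  \<open>B\<close> is the stated integral only once countable additivity is known; that follows by
  monotone convergence from the additivity of each \<open>\<xi> \<omega>\<close>.\<close>

lemma nn_integral_point_process_finite:
  assumes \<xi>: "point_process P X \<xi>" and fin: "finite_measure (intensity_measure P X \<xi>)"
    and B: "B \<in> sets X"
  shows "(\<integral>\<^sup>+\<omega>. emeasure (\<xi> \<omega>) B \<partial>P) < \<infinity>"
proof -
  let ?\<mu> = "\<lambda>B. \<integral>\<^sup>+\<omega>. emeasure (\<xi> \<omega>) B \<partial>P"
  have s: "sets (\<xi> \<omega>) = sets X" if "\<omega> \<in> space P" for \<omega>
    using point_process_space[OF \<xi> that] by (simp add: counting_measures_def)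
  have "emeasure (intensity_measure P X \<xi>) B = ?\<mu> B"
  proof (rule emeasure_measure_of[OF intensity_measure_def])
    show "sets X \<subseteq> Pow (space X)"
      by (rule sets.space_closed)
    show "B \<in> sets (intensity_measure P X \<xi>)"
      using B by (simp add: intensity_measure_def)
    show "positive (sets (intensity_measure P X \<xi>)) ?\<mu>"
      by (simp add: positive_def)
    show "countably_additive (sets (intensity_measure P X \<xi>)) ?\<mu>"
    proof (rule countably_additiveI)
      fix A :: "nat \<Rightarrow> _"
      assume "range A \<subseteq> sets (intensity_measure P X \<xi>)" and dis: "disjoint_family A"
      then have A: "range A \<subseteq> sets X"
        by (simp add: intensity_measure_def)
      have "(\<Sum>i. ?\<mu> (A i)) = (\<integral>\<^sup>+\<omega>. (\<Sum>i. emeasure (\<xi> \<omega>) (A i)) \<partial>P)"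
        using A by (intro nn_integral_suminf[symmetric] measurable_emeasure_point_process[OF \<xi>]) auto
      also have "\<dots> = ?\<mu> (\<Union>i. A i)"
        using A s dis by (intro nn_integral_cong suminf_emeasure) auto
      finally show "(\<Sum>i. ?\<mu> (A i)) = ?\<mu> (\<Union>i. A i)" .
    qed
  qed
  then show ?thesis
    using finite_measure.emeasure_finite[OF fin, of B] by (simp add: top.not_eq_extremum)
qed

lemma integrable_count_point_process:
  assumes \<xi>: "point_process P X \<xi>" and fin: "finite_measure (intensity_measure P X \<xi>)"
    and B: "B \<in> sets X"
  shows "integrable P (\<lambda>\<omega>. real (nat \<lfloor>measure (\<xi> \<omega>) B\<rfloor>))"
proof (rule integrableI_bounded)
  show "(\<lambda>\<omega>. real (nat \<lfloor>measure (\<xi> \<omega>) B\<rfloor>)) \<in> borel_measurable P"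
    by (rule measurable_compose[OF measurable_count_point_process[OF \<xi> B]]) simp
  have "(\<integral>\<^sup>+\<omega>. ennreal (norm (real (nat \<lfloor>measure (\<xi> \<omega>) B\<rfloor>))) \<partial>P) \<le> (\<integral>\<^sup>+\<omega>. emeasure (\<xi> \<omega>) B \<partial>P)"
  proof (rule nn_integral_mono)
    fix \<omega>
    have "ennreal (norm (real (nat \<lfloor>measure (\<xi> \<omega>) B\<rfloor>))) \<le> ennreal (measure (\<xi> \<omega>) B)"
      by (intro ennreal_leI) simp
    also have "\<dots> \<le> emeasure (\<xi> \<omega>) B"
      by (cases "emeasure (\<xi> \<omega>) B = \<infinity>") (simp_all add: emeasure_eq_ennreal_measure)
    finally show "ennreal (norm (real (nat \<lfloor>measure (\<xi> \<omega>) B\<rfloor>))) \<le> emeasure (\<xi> \<omega>) B" .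
  qed
  also have "\<dots> < \<infinity>"
    by (rule nn_integral_point_process_finite[OF assms])
  finally show "(\<integral>\<^sup>+\<omega>. ennreal (norm (real (nat \<lfloor>measure (\<xi> \<omega>) B\<rfloor>))) \<partial>P) < \<infinity>" .
qed

section \<open>Counts of a Poisson process\<close>

lemma prob_count_poisson:
  assumes \<eta>: "poisson_process Q X \<Lambda> \<eta>" and \<Lambda>: "finite_measure \<Lambda>" and B: "B \<in> sets X"
  shows "measure Q {\<omega> \<in> space Q. nat \<lfloor>measure (\<eta> \<omega>) B\<rfloor> = k} = pois (measure \<Lambda> B) k"
proof -
  have pp: "point_process Q X \<eta>" using \<eta> by (simp add: poisson_process_def)
  then interpret prob_space Q by (simp add: point_process_def)
  note em[measurable] = measurable_emeasure_point_process[OF pp B]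
  let ?E = "\<lambda>k :: nat. {\<omega> \<in> space Q. emeasure (\<eta> \<omega>) B = of_nat k}"
  have law: "prob (?E k) = pois (measure \<Lambda> B) k" for k
    using \<eta> B finite_measure.emeasure_finite[OF \<Lambda>, of B]
    by (simp add: poisson_process_def pois_def)
  \<comment> \<open>The Poisson weights sum to 1, so the count is almost surely finite, and there
    its conversion to a natural number agrees with the value of \<open>emeasure\<close>.\<close>
  have "(\<lambda>k. prob (?E k)) sums prob (\<Union>k. ?E k)"
    by (intro finite_measure_UNION) (auto simp: disjoint_family_on_def)
  then have "prob (\<Union>k. ?E k) = 1"
    unfolding law using pois_sums by (rule sums_unique2)
  then have "AE \<omega> in Q. \<omega> \<in> (\<Union>k. ?E k)"
    by (subst AE_in_set_eq_1) auto
  then have "prob {\<omega> \<in> space Q. nat \<lfloor>measure (\<eta> \<omega>) B\<rfloor> = k} = prob (?E k)"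
  proof (intro finite_measure_eq_AE, elim AE_mp, intro AE_I2 impI)
    fix \<omega> assume "\<omega> \<in> (\<Union>k. ?E k)"
    then obtain j where "emeasure (\<eta> \<omega>) B = of_nat j" and \<omega>: "\<omega> \<in> space Q" by auto
    then have "measure (\<eta> \<omega>) B = real j" "emeasure (\<eta> \<omega>) B = ennreal (real j)"
      by (simp_all add: measure_def ennreal_of_nat_eq_real_of_nat)
    then show "\<omega> \<in> {\<omega> \<in> space Q. nat \<lfloor>measure (\<eta> \<omega>) B\<rfloor> = k} \<longleftrightarrow> \<omega> \<in> ?E k"
      using \<omega> by (simp add: ennreal_of_nat_eq_real_of_nat)
  qed (use measurable_count_point_process[OF pp B] in \<open>auto simp: pred_def[symmetric]\<close>)
  then show ?thesis
    by (simp add: law)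
qed

lemma disj_tuples_drop:
  assumes "A \<in> disj_tuples X" "i < length A"
  shows "drop i A \<in> disj_tuples X"
  using assms set_drop_subset[of i A]
  by (fastforce simp: disj_tuples_def disjoint_family_on_def)

lemma disj_tuples_take:
  assumes "A \<in> disj_tuples X" "0 < i"
  shows "take i A \<in> disj_tuples X"
  using assms set_take_subset[of i A]
  by (fastforce simp: disj_tuples_def disjoint_family_on_def)

lemma prob_counts_poisson:
  assumes \<eta>: "poisson_process Q X \<Lambda> \<eta>" and A: "A \<in> disj_tuples X" and m: "length m = length A"
  shows "measure Q {\<omega> \<in> space Q. counts (\<eta> \<omega>) A = m} =
    (\<Prod>i<length A. measure Q {\<omega> \<in> space Q. nat \<lfloor>measure (\<eta> \<omega>) (A ! i)\<rfloor> = m ! i})"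
proof -
  have pp: "point_process Q X \<eta>" using \<eta> by (simp add: poisson_process_def)
  then interpret prob_space Q by (simp add: point_process_def)
  have "indep_vars (\<lambda>_. borel) (\<lambda>i \<omega>. emeasure (\<eta> \<omega>) (A ! i)) {..<length A}"
    using \<eta> A by (simp add: poisson_process_def)
  then have ind: "indep_vars (\<lambda>_. count_space UNIV) (\<lambda>i \<omega>. nat \<lfloor>enn2real (emeasure (\<eta> \<omega>) (A ! i))\<rfloor>) {..<length A}"
    by (rule indep_vars_compose2) measurable
  have ne: "{..<length A} \<noteq> {}" using A by (auto simp: disj_tuples_def)
  have "{\<omega> \<in> space Q. counts (\<eta> \<omega>) A = m} =
      (\<Inter>i<length A. (\<lambda>\<omega>. nat \<lfloor>enn2real (emeasure (\<eta> \<omega>) (A ! i))\<rfloor>) -` {m ! i} \<inter> space Q)"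
    using ne m by (auto simp: counts_def list_eq_iff_nth_eq measure_def)
  then show ?thesis
    using indep_varsD_finite[OF ind ne, of "\<lambda>i. {m ! i}"]
    by (simp add: measure_def[of "\<eta> _"] vimage_def Int_def conj_commute)
qed

text \<open>This is the form of independence that \<open>expectation_indep_countable\<close> asks
  for; it compares the product formulas for \<open>B # A\<close> and for \<open>A\<close>. The empty
  tuple is not in \<open>disj_tuples\<close>, so \<open>A = []\<close> is treated apart: its count
  vector is always \<open>[]\<close>.\<close>

lemma prob_counts_poisson_Cons:
  assumes \<eta>: "poisson_process Q X \<Lambda> \<eta>" and A: "B # A \<in> disj_tuples X"
  shows "measure Q {\<omega> \<in> space Q. nat \<lfloor>measure (\<eta> \<omega>) B\<rfloor> = k \<and> counts (\<eta> \<omega>) A = m} =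
    measure Q {\<omega> \<in> space Q. nat \<lfloor>measure (\<eta> \<omega>) B\<rfloor> = k} * measure Q {\<omega> \<in> space Q. counts (\<eta> \<omega>) A = m}"
proof -
  interpret prob_space Q using \<eta> by (simp add: poisson_process_def point_process_def)
  show ?thesis
  proof (cases "length m = length A")
    case False
    then have "counts (\<eta> \<omega>) A \<noteq> m" for \<omega> by (auto simp: counts_def)
    then show ?thesis by simp
  next
    case m: True
    show ?thesis
    proof (cases "A = []")
      case True
      then show ?thesis using m by (simp add: counts_def prob_space)
    next
      case False
      then have A': "A \<in> disj_tuples X"
        using disj_tuples_drop[OF A, of 1] by simp
      have "{\<omega> \<in> space Q. nat \<lfloor>measure (\<eta> \<omega>) B\<rfloor> = k \<and> counts (\<eta> \<omega>) A = m} =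
          {\<omega> \<in> space Q. counts (\<eta> \<omega>) (B # A) = k # m}"
        by (simp add: counts_def)
      then show ?thesis
        using prob_counts_poisson[OF \<eta> A, of "k # m"] prob_counts_poisson[OF \<eta> A' m] m
        by (simp add: lessThan_Suc_eq_insert_0 prod.reindex del: prod.lessThan_Suc)
    qed
  qed
qed

lemma integrable_poisson_counts:
  assumes \<eta>: "poisson_process Q X \<Lambda> \<eta>" and \<Lambda>: "finite_measure \<Lambda>" and A: "set A \<subseteq> sets X"
    and g: "g \<in> lipschitz1 (length A)"
  shows "integrable Q (\<lambda>\<omega>. g (counts (\<eta> \<omega>) A))"
proof -
  have pp: "point_process Q X \<eta>" using \<eta> by (simp add: poisson_process_def)
  then interpret prob_space Q by (simp add: point_process_def)
  show ?thesis
  proof (rule integrable_lipschitz1[OF measurable_counts[OF pp A] _ _ g])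
    fix i assume "i < length A"
    moreover from this A have B: "A ! i \<in> sets X" by auto
    ultimately show "integrable Q (\<lambda>\<omega>. real (counts (\<eta> \<omega>) A ! i))"
      using integrable_pois_lip[OF measurable_count_point_process[OF pp B] prob_count_poisson[OF \<eta> \<Lambda> B]
          _ lip_linear[of 1]]
      by (simp add: counts_def)
  qed (simp add: counts_def)
qed

lemma lipschitz1_append:
  assumes "g \<in> lipschitz1 (length x + n)"
  shows "(\<lambda>y. g (x @ y)) \<in> lipschitz1 n"
  unfolding lipschitz1_def
proof (intro CollectI allI impI)
  fix y z :: "nat list" assume yz: "length y = n" "length z = n"
  have "(\<Sum>i<length x + n. \<bar>real ((x @ y) ! i) - real ((x @ z) ! i)\<bar>) = (\<Sum>i<n. \<bar>real (y ! i) - real (z ! i)\<bar>)"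
    by (induction n) (simp_all add: nth_append)
  then show "\<bar>g (x @ y) - g (x @ z)\<bar> \<le> (\<Sum>i<n. \<bar>real (y ! i) - real (z ! i)\<bar>)"
    using lipschitz1D[OF assms, of "x @ y" "x @ z"] yz by simp
qed

text \<open>By independence the first count can be frozen while the others are integrated. It then
  joins the prefix \<open>x\<close>, the induction hypothesis evaluates the inner integral, and the
  outer one is a Poisson mean, as in the recursion of \<open>hybrid\<close>.\<close>

lemma expectation_poisson_counts:
  assumes \<eta>: "poisson_process Q X \<Lambda> \<eta>" and \<Lambda>: "finite_measure \<Lambda>"
    and "A = [] \<or> A \<in> disj_tuples X" and "g \<in> lipschitz1 (length x + length A)"
  shows "(\<integral>\<omega>. g (x @ counts (\<eta> \<omega>) A) \<partial>Q) = hybrid (map (measure \<Lambda>) A) g x"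
  using assms(3,4)
proof (induction A arbitrary: x)
  case Nil
  interpret prob_space Q using \<eta> by (simp add: poisson_process_def point_process_def)
  show ?case by (simp add: counts_def prob_space)
next
  case (Cons B A)
  have pp: "point_process Q X \<eta>" using \<eta> by (simp add: poisson_process_def)
  then interpret prob_space Q by (simp add: point_process_def)
  have BA: "B # A \<in> disj_tuples X" using Cons.prems by simp
  then have sets: "B \<in> sets X" "set A \<subseteq> sets X" by (auto simp: disj_tuples_def)
  have A: "A = [] \<or> A \<in> disj_tuples X"
    using disj_tuples_drop[OF BA, of 1] by auto
  let ?N = "\<lambda>\<omega>. nat \<lfloor>measure (\<eta> \<omega>) B\<rfloor>" and ?h = "hybrid (map (measure \<Lambda>) A) g"
  have h: "?h \<in> lipschitz1 (Suc (length x))"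
    using Cons.prems(2) by (intro lipschitz1_hybrid) auto
  have c: "counts (\<eta> \<omega>) (B # A) = ?N \<omega> # counts (\<eta> \<omega>) A" for \<omega>
    by (simp add: counts_def)
  have int: "integrable Q (\<lambda>\<omega>. g (x @ counts (\<eta> \<omega>) (B # A)))"
    using integrable_poisson_counts[OF \<eta> \<Lambda>, of "B # A", OF _ lipschitz1_append[OF Cons.prems(2)]] sets
    by simp
  have "(\<integral>\<omega>. g (x @ counts (\<eta> \<omega>) (B # A)) \<partial>Q) =
      (\<integral>\<omega>. (\<integral>\<omega>'. g (x @ ?N \<omega> # counts (\<eta> \<omega>') A) \<partial>Q) \<partial>Q)"
    using expectation_indep_countable[OF measurable_count_point_process[OF pp sets(1)]
        measurable_counts[OF pp sets(2)] prob_counts_poisson_Cons[OF \<eta> BA],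
        of "\<lambda>(k, m). g (x @ k # m)"] int
    by (simp add: c)
  also have "\<dots> = (\<integral>\<omega>. ?h (x @ [?N \<omega>]) \<partial>Q)"
    using Cons.IH[OF A, of "x @ [k]" for k] Cons.prems(2) by simp
  also have "\<dots> = pois_mean (measure \<Lambda> B) (\<lambda>k. ?h (x @ [k]))"
    by (rule expectation_pois_lip[OF measurable_count_point_process[OF pp sets(1)]
        prob_count_poisson[OF \<eta> \<Lambda> sets(1)] _ lip_snoc[OF h]]) simp_all
  finally show ?case by simp
qed

section \<open>Exchanging the coordinates one by one\<close>

theorem theorem1p3:
  fixes X :: "'a measure" and P :: "'w measure" and Q :: "'v measure"
    and \<xi> :: "'w \<Rightarrow> 'a measure" and \<eta> :: "'v \<Rightarrow> 'a measure" and \<Lambda> :: "'a measure"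
    and Z :: "'a set list \<Rightarrow> 'w \<Rightarrow> int list"
  assumes "point_process P X \<xi>"
    and "finite_measure (intensity_measure P X \<xi>)"
    and "poisson_process Q X \<Lambda> \<eta>"
    and "finite_measure \<Lambda>"
    and "\<And>A. A \<in> disj_tuples X \<Longrightarrow> Z A \<in> P \<rightarrow>\<^sub>M count_space {z. length z = length A}"
  shows "dist_pi X P \<xi> Q \<eta> \<le>
    (SUP A\<in>disj_tuples X. \<Sum>i=1..length A.
       (\<Sum>\<^sub>\<infinity>m\<in>{m. length m = i \<and> last m \<noteq> 0}.
          ennreal \<bar>q_coeff P \<xi> \<Lambda> (take i A) (Z (take i A)) m\<bar>) +
       2 * emeasure \<Lambda> (A ! (i - 1)) *
         (\<Sum>j<i. \<integral>\<^sup>+ \<omega>. ennreal \<bar>real_of_int (Z (take i A) \<omega> ! j)\<bar> \<partial>P))"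
  unfolding dist_pi_def wasserstein_def
\<comment> \<open>For a fixed tuple \<open>A\<close> and test function \<open>g\<close>, the
  right-hand sum for the same \<open>A\<close> is already a bound.\<close>
proof (rule SUP_least, rule SUP_upper2, assumption, rule SUP_least)
  fix A g assume A: "A \<in> disj_tuples X" and g: "g \<in> lipschitz1 (length A)"
  interpret prob_space P using assms(1) by (simp add: point_process_def)
  define d where "d = length A"
  define ls where "ls = map (measure \<Lambda>) A"
  define h where "h i = hybrid (drop i ls) g" for i
  \<comment> \<open>In \<open>a i\<close> the first \<open>i\<close> coordinates are counts of
    \<open>\<xi>\<close> and the others are averaged over independent Poisson variables. So
    \<open>a d\<close> is the expectation for \<open>\<xi>\<close> and \<open>a 0\<close> the one
    for \<open>\<eta>\<close>.\<close>
  define a where "a i = (\<integral>\<omega>. h i (counts (\<xi> \<omega>) (take i A)) \<partial>P)" for i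
  define r where "r i = (\<Sum>\<^sub>\<infinity>m\<in>{m. length m = i \<and> last m \<noteq> 0}.
          ennreal \<bar>q_coeff P \<xi> \<Lambda> (take i A) (Z (take i A)) m\<bar>) +
       2 * emeasure \<Lambda> (A ! (i - 1)) *
         (\<Sum>j<i. \<integral>\<^sup>+ \<omega>. ennreal \<bar>real_of_int (Z (take i A) \<omega> ! j)\<bar> \<partial>P)" for i
  have step: "ennreal \<bar>a (Suc n) - a n\<bar> \<le> r (Suc n)" if n: "n < d" for n
  proof -
    let ?A = "take (Suc n) A"
    have tA: "?A \<in> disj_tuples X" using disj_tuples_take[OF A] by simp
    then have sA: "set ?A \<subseteq> sets X" by (simp add: disj_tuples_def)
    have lA: "length ?A = Suc n" using n by (simp add: d_def)
    have snoc: "?A = take n A @ [A ! n]"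
      using n by (simp add: d_def take_Suc_conv_app_nth)
    have "g \<in> lipschitz1 (Suc n + length (drop (Suc n) ls))"
      using g n by (simp add: d_def ls_def del: add_Suc)
    then have h: "h (Suc n) \<in> lipschitz1 (Suc n)"
      unfolding h_def by (intro lipschitz1_hybrid) (auto simp: d_def ls_def dest!: in_set_dropD)
    \<comment> \<open>Positions start at 0, so \<open>A ! n\<close> is the last set of the prefix of
      length \<open>Suc n\<close>. Averaging \<open>h (Suc n)\<close> over that coordinate gives
      \<open>h n\<close>, which makes \<open>a n\<close> the Poisson term in
      \<open>poisson_step\<close>.\<close>
    have hn: "h n = (\<lambda>x. pois_mean (measure \<Lambda> (A ! n)) (\<lambda>k. h (Suc n) (x @ [k])))"
      unfolding h_def using n by (simp add: d_def ls_def Cons_nth_drop_Suc[symmetric] fun_eq_iff)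
    have an: "a n = (\<integral>\<omega>. pois_mean (measure \<Lambda> (A ! n))
        (\<lambda>k. h (Suc n) (butlast (counts (\<xi> \<omega>) ?A) @ [k])) \<partial>P)"
      unfolding a_def hn by (simp add: snoc counts_def)
    have len: "length (counts (\<xi> \<omega>) ?A) = Suc n" for \<omega>
      using lA by (simp add: counts_def)
    have int: "integrable P (\<lambda>\<omega>. real (counts (\<xi> \<omega>) ?A ! i))" if i: "i < Suc n" for i
    proof -
      have "?A ! i \<in> sets X" using sA lA i by (metis nth_mem subsetD)
      from integrable_count_point_process[OF assms(1,2) this]
      show ?thesis using lA i by (simp add: counts_def)
    qed
    have Z: "Z ?A \<in> P \<rightarrow>\<^sub>M count_space {z. length z = Suc n}"
      using assms(5)[OF tA] by (simp only: lA)
    have l: "ennreal (measure \<Lambda> (A ! n)) = emeasure \<Lambda> (A ! n)"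
      by (simp add: finite_measure.emeasure_eq_measure[OF assms(4)])
    have last: "last ?A = A ! n" using snoc by simp
    show ?thesis
      using poisson_step[OF measurable_counts[OF assms(1) sA] len int Z _ h, of "measure \<Lambda> (A ! n)"]
      unfolding an unfolding a_def r_def q_coeff_def l last by simp
  qed
  have tele: "ennreal \<bar>a n - a 0\<bar> \<le> (\<Sum>i=1..n. r i)" if "n \<le> d" for n
    using that
  proof (induction n)
    case (Suc n)
    have "ennreal \<bar>a (Suc n) - a 0\<bar> \<le> ennreal \<bar>a n - a 0\<bar> + ennreal \<bar>a (Suc n) - a n\<bar>"
      unfolding ennreal_plus[OF abs_ge_zero abs_ge_zero, symmetric] by (rule ennreal_leI) linarith
    also have "\<dots> \<le> (\<Sum>i=1..n. r i) + r (Suc n)"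
      using Suc by (intro add_mono step) auto
    finally show ?case by simp
  qed simp
  have "a d = (\<integral>\<omega>. g (counts (\<xi> \<omega>) A) \<partial>P)"
    by (simp add: a_def h_def d_def ls_def)
  moreover have "a 0 = (\<integral>\<omega>. g (counts (\<eta> \<omega>) A) \<partial>Q)"
    using expectation_poisson_counts[OF assms(3,4), of A g "[]"] A g
    by (simp add: a_def h_def ls_def counts_def prob_space)
  ultimately show "ennreal \<bar>(\<integral>\<omega>. g (counts (\<xi> \<omega>) A) \<partial>P) - (\<integral>\<omega>. g (counts (\<eta> \<omega>) A) \<partial>Q)\<bar> \<le>
      (\<Sum>i=1..length A. r i)"
    using tele[of d] by (simp add: d_def)
qed

end
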